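(* Let $R$ be an integral domain and let $G$ be a subgroup of $\mathrm{Aut}(R)$ whose action on $R$ is locally finite. If $R$ is a locally pqr domain, then the fixed ring $R^G$ is also a locally pqr domain.
   Context: All rings are commutative with unity. $\mathrm{Aut}(R)$ is the group of ring automorphisms of $R$. For a subgroup $G$ of $\mathrm{Aut}(R)$, the fixed ring is $R^G=\{r\in R : \sigma(r)=r \text{ for all } \sigma\in G\}$. The action of $G$ on $R$ is locally finite if for every $r\in R$ the orbit $\{\sigma(r) : \sigma\in G\}$ is finite ($G$ itself need not be finite). A quotient ring (localization) $R'$ of an integral domain $R$ with respect to a multiplicative set is called a principal quotient ring (pqr) of $R$ if $R'=R_M$ for a multiplicative set $M=\{1,t,t^2,\dots,t^n,\dots\}$ generated by a single (nonzero) element $t\in R$; equality is understood as subrings of the quotient field of $R$. An integral domain $R$ is called locally pqr if for every prime ideal $\mathfrak{p}$ of $R$, the localization $R_{\mathfrak{p}}$ is a principal quotient ring of $R$. *)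

theory Defs
  imports "HOL-Algebra.Algebra"
begin

section \<open>The automorphism group of a ring\<close>

text \<open>
  As for the group automorphisms \<^term>\<open>auto G\<close> in HOL-Algebra, only extensional functions are
  admitted, so that an automorphism is determined by its values on the carrier.
\<close>

definition ring_auto :: "('a, 'm) ring_scheme \<Rightarrow> ('a \<Rightarrow> 'a) set"
  where "ring_auto R = ring_iso R R \<inter> Bij (carrier R)"

definition RingAutoGroup :: "('a, 'm) ring_scheme \<Rightarrow> ('a \<Rightarrow> 'a) monoid"
  where "RingAutoGroup R = BijGroup (carrier R) \<lparr>carrier := ring_auto R\<rparr>"

definition fixed_ring :: "('a, 'm) ring_scheme \<Rightarrow> ('a \<Rightarrow> 'a) set \<Rightarrow> ('a, 'm) ring_scheme"
  where "fixed_ring R G = R\<lparr>carrier := {r \<in> carrier R. \<forall>\<sigma>\<in>G. \<sigma> r = r}\<rparr>"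

definition locally_finite_action :: "('a, 'm) ring_scheme \<Rightarrow> ('a \<Rightarrow> 'a) set \<Rightarrow> bool"
  where "locally_finite_action R G \<longleftrightarrow> (\<forall>r\<in>carrier R. finite {\<sigma> r | \<sigma>. \<sigma> \<in> G})"

lemma (in ring) subgroup_ring_auto: "subgroup (ring_auto R) (BijGroup (carrier R))"
proof (rule group.subgroupI[OF group_BijGroup])
  show "ring_auto R \<subseteq> carrier (BijGroup (carrier R))"
    by (auto simp: ring_auto_def BijGroup_def)
  have "(\<lambda>x\<in>carrier R. x) \<in> ring_auto R"
    by (auto simp: ring_auto_def ring_iso_def ring_hom_def id_Bij bij_betw_def inj_on_def)
  then show "ring_auto R \<noteq> {}" by blast
next
  fix f assume f: "f \<in> ring_auto R"
  let ?g = "\<lambda>x\<in>carrier R. inv_into (carrier R) f x"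
  from f have fB: "f \<in> Bij (carrier R)" and fh: "f \<in> ring_hom R R"
    and bij: "bij_betw f (carrier R) (carrier R)"
    by (auto simp: ring_auto_def ring_iso_def)
  have g: "?g \<in> Bij (carrier R)" by (rule restrict_inv_into_Bij[OF fB])
  have "?g \<in> ring_hom R R"
  proof (rule ring_hom_memI)
    fix x y assume x: "x \<in> carrier R" and y: "y \<in> carrier R"
    show "?g x \<in> carrier R" using x fB by (simp add: Bij_inv_into_mem)
    have "inv_into (carrier R) f (x \<otimes> y)
        = inv_into (carrier R) f x \<otimes> inv_into (carrier R) f y"
      by (rule Bij_inv_into_lemma[OF _ fB _ x y]) (auto simp: ring_hom_mult[OF fh])
    then show "?g (x \<otimes> y) = ?g x \<otimes> ?g y" using x y by simp
    have "inv_into (carrier R) f (x \<oplus> y)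
        = inv_into (carrier R) f x \<oplus> inv_into (carrier R) f y"
      by (rule Bij_inv_into_lemma[OF _ fB _ x y]) (auto simp: ring_hom_add[OF fh])
    then show "?g (x \<oplus> y) = ?g x \<oplus> ?g y" using x y by simp
  next
    have "inv_into (carrier R) f (f \<one>) = \<one>"
      using bij by (intro inv_into_f_f) (auto simp: bij_betw_def)
    then show "?g \<one> = \<one>" by (simp add: ring_hom_one[OF fh])
  qed
  with g f show "inv\<^bsub>BijGroup (carrier R)\<^esub> f \<in> ring_auto R"
    by (auto simp: inv_BijGroup[OF fB] ring_auto_def ring_iso_def Bij_def)
next
  fix f g assume f: "f \<in> ring_auto R" and g: "g \<in> ring_auto R"
  then have B: "f \<in> Bij (carrier R)" "g \<in> Bij (carrier R)"
    and h: "f \<in> ring_hom R R" "g \<in> ring_hom R R"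
    by (auto simp: ring_auto_def ring_iso_def)
  have c: "compose (carrier R) f g \<in> Bij (carrier R)" by (rule compose_Bij[OF B])
  have "compose (carrier R) f g \<in> ring_hom R R"
    using ring_hom_closed[OF h(2)] ring_hom_closed[OF h(1)]
    by (intro ring_hom_memI)
      (simp_all add: compose_def ring_hom_mult[OF h(1)] ring_hom_mult[OF h(2)]
        ring_hom_add[OF h(1)] ring_hom_add[OF h(2)] ring_hom_one[OF h(1)] ring_hom_one[OF h(2)])
  with c show "f \<otimes>\<^bsub>BijGroup (carrier R)\<^esub> g \<in> ring_auto R"
    using B by (auto simp: BijGroup_def ring_auto_def ring_iso_def Bij_def)
qed

theorem (in ring) RingAutoGroup: "group (RingAutoGroup R)"
  by (simp add: RingAutoGroup_def subgroup.subgroup_is_group subgroup_ring_auto group_BijGroup)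


section \<open>The quotient field of a domain and its localizations\<close>

text \<open>The fraction $a/b$ as an equivalence class of pairs.\<close>

definition frac_of :: "('a, 'm) ring_scheme \<Rightarrow> 'a \<Rightarrow> 'a \<Rightarrow> ('a \<times> 'a) set"
  where "frac_of R a b =
    {(c, d). c \<in> carrier R \<and> d \<in> carrier R - {\<zero>\<^bsub>R\<^esub>} \<and> a \<otimes>\<^bsub>R\<^esub> d = c \<otimes>\<^bsub>R\<^esub> b}"

text \<open>
  Each union below ranges over representatives of the operands; the sets united all coincide
  (see \<open>quotient_field_mult\<close> and \<open>quotient_field_add\<close>).
\<close>

definition quotient_field :: "('a, 'm) ring_scheme \<Rightarrow> ('a \<times> 'a) set ring"
  where "quotient_field R =
    \<lparr>carrier = {frac_of R a b | a b. a \<in> carrier R \<and> b \<in> carrier R - {\<zero>\<^bsub>R\<^esub>}},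
     monoid.mult = (\<lambda>U V. \<Union>(a, b)\<in>U. \<Union>(c, d)\<in>V.
       frac_of R (a \<otimes>\<^bsub>R\<^esub> c) (b \<otimes>\<^bsub>R\<^esub> d)),
     one = frac_of R \<one>\<^bsub>R\<^esub> \<one>\<^bsub>R\<^esub>,
     ring.zero = frac_of R \<zero>\<^bsub>R\<^esub> \<one>\<^bsub>R\<^esub>,
     add = (\<lambda>U V. \<Union>(a, b)\<in>U. \<Union>(c, d)\<in>V.
       frac_of R (a \<otimes>\<^bsub>R\<^esub> d \<oplus>\<^bsub>R\<^esub> c \<otimes>\<^bsub>R\<^esub> b) (b \<otimes>\<^bsub>R\<^esub> d))\<rparr>"

text \<open>
  The ring $R_M$ as a subring of the quotient field of the domain $R$, for a multiplicative set
  \<open>M\<close> not containing zero. Since only the carrier depends on \<open>M\<close>, two localizations of \<open>R\<close> are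
  equal iff they are the same subset of the quotient field.
\<close>

definition localization :: "('a, 'm) ring_scheme \<Rightarrow> 'a set \<Rightarrow> ('a \<times> 'a) set ring"
  where "localization R M =
    (quotient_field R)\<lparr>carrier := {frac_of R a s | a s. a \<in> carrier R \<and> s \<in> M}\<rparr>"

definition localization_at_prime :: "('a, 'm) ring_scheme \<Rightarrow> 'a set \<Rightarrow> ('a \<times> 'a) set ring"
  where "localization_at_prime R P = localization R (carrier R - P)"

definition principal_quotient_ring :: "('a \<times> 'a) set ring \<Rightarrow> ('a, 'm) ring_scheme \<Rightarrow> bool"
  where "principal_quotient_ring R' R \<longleftrightarrow>
    (\<exists>t\<in>carrier R - {\<zero>\<^bsub>R\<^esub>}. R' = localization R {t [^]\<^bsub>R\<^esub> n | n :: nat. True})"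

definition locally_pqr :: "('a, 'm) ring_scheme \<Rightarrow> bool"
  where "locally_pqr R \<longleftrightarrow> domain R \<and>
    (\<forall>P. primeideal P R \<longrightarrow> principal_quotient_ring (localization_at_prime R P) R)"

context domain
begin

lemma frac_of_eq_iff:
  assumes "a \<in> carrier R" "b \<in> carrier R - {\<zero>}" "c \<in> carrier R" "d \<in> carrier R - {\<zero>}"
  shows "frac_of R a b = frac_of R c d \<longleftrightarrow> a \<otimes> d = c \<otimes> b"
proof
  assume "frac_of R a b = frac_of R c d"
  moreover have "(c, d) \<in> frac_of R c d" using assms by (simp add: frac_of_def)
  ultimately show "a \<otimes> d = c \<otimes> b" by (auto simp: frac_of_def)
next
  have *: "a \<otimes> y = x \<otimes> b"
    if c: "a \<in> carrier R" "b \<in> carrier R" "c \<in> carrier R" "d \<in> carrier R - {\<zero>}"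
      and xy: "x \<in> carrier R" "y \<in> carrier R"
      and e: "a \<otimes> d = c \<otimes> b" and xe: "c \<otimes> y = x \<otimes> d" for a b c d x y
  proof -
    have "d \<otimes> (a \<otimes> y) = (a \<otimes> d) \<otimes> y" using c xy by (simp add: m_ac)
    also have "\<dots> = b \<otimes> (c \<otimes> y)" unfolding e using c xy by (simp add: m_ac)
    also have "\<dots> = d \<otimes> (x \<otimes> b)" unfolding xe using c xy by (simp add: m_ac)
    finally show ?thesis using c xy m_lcancel[of d "a \<otimes> y" "x \<otimes> b"] by auto
  qed
  assume e: "a \<otimes> d = c \<otimes> b"
  show "frac_of R a b = frac_of R c d"
  proof (intro Set.set_eqI iffI)
    fix z assume "z \<in> frac_of R a b"
    then show "z \<in> frac_of R c d"
      using *[of c d a b "fst z" "snd z"] assms e by (auto simp: frac_of_def)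
  next
    fix z assume "z \<in> frac_of R c d"
    then show "z \<in> frac_of R a b"
      using *[of a b c d "fst z" "snd z"] assms e by (auto simp: frac_of_def)
  qed
qed

lemma mem_frac_ofD:
  assumes "a \<in> carrier R" "b \<in> carrier R - {\<zero>}" "(c, d) \<in> frac_of R a b"
  shows "c \<in> carrier R" "d \<in> carrier R - {\<zero>}" "a \<otimes> d = c \<otimes> b"
  using assms by (auto simp: frac_of_def)

lemma frac_of_self: "a \<in> carrier R \<Longrightarrow> b \<in> carrier R - {\<zero>} \<Longrightarrow> (a, b) \<in> frac_of R a b"
  by (simp add: frac_of_def)

lemma mult_nonzero:
  "b \<in> carrier R - {\<zero>} \<Longrightarrow> d \<in> carrier R - {\<zero>} \<Longrightarrow> b \<otimes> d \<in> carrier R - {\<zero>}"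
  using integral by auto

lemma quotient_field_mult:
  assumes a: "a \<in> carrier R" and b: "b \<in> carrier R - {\<zero>}"
    and c: "c \<in> carrier R" and d: "d \<in> carrier R - {\<zero>}"
  shows "frac_of R a b \<otimes>\<^bsub>quotient_field R\<^esub> frac_of R c d = frac_of R (a \<otimes> c) (b \<otimes> d)"
proof -
  have "frac_of R (x \<otimes> z) (y \<otimes> w) = frac_of R (a \<otimes> c) (b \<otimes> d)"
    if "(x, y) \<in> frac_of R a b" "(z, w) \<in> frac_of R c d" for x y z w
  proof -
    note xy = mem_frac_ofD[OF a b that(1)] and zw = mem_frac_ofD[OF c d that(2)]
    have "(x \<otimes> z) \<otimes> (b \<otimes> d) = (x \<otimes> b) \<otimes> (z \<otimes> d)" using a b c d xy(1,2) zw(1,2) by (simp add: m_ac)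
    also have "\<dots> = (a \<otimes> y) \<otimes> (c \<otimes> w)" using xy zw by simp
    also have "\<dots> = (a \<otimes> c) \<otimes> (y \<otimes> w)" using a b c d xy(1,2) zw(1,2) by (simp add: m_ac)
    finally show ?thesis
      using a b c d xy(1,2) zw(1,2) mult_nonzero[OF b d] mult_nonzero[OF xy(2) zw(2)]
      by (subst frac_of_eq_iff) auto
  qed
  then have "(\<Union>(x, y)\<in>frac_of R a b. \<Union>(z, w)\<in>frac_of R c d. frac_of R (x \<otimes> z) (y \<otimes> w))
      = (\<Union>p\<in>frac_of R a b. \<Union>q\<in>frac_of R c d. frac_of R (a \<otimes> c) (b \<otimes> d))"
    by (intro SUP_cong refl) (auto split: prod.splits)
  also have "\<dots> = frac_of R (a \<otimes> c) (b \<otimes> d)"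
    using frac_of_self[OF a b] frac_of_self[OF c d] by blast
  finally show ?thesis by (simp add: quotient_field_def)
qed

lemma quotient_field_add:
  assumes a: "a \<in> carrier R" and b: "b \<in> carrier R - {\<zero>}"
    and c: "c \<in> carrier R" and d: "d \<in> carrier R - {\<zero>}"
  shows "frac_of R a b \<oplus>\<^bsub>quotient_field R\<^esub> frac_of R c d
    = frac_of R (a \<otimes> d \<oplus> c \<otimes> b) (b \<otimes> d)"
proof -
  have "frac_of R (x \<otimes> w \<oplus> z \<otimes> y) (y \<otimes> w) = frac_of R (a \<otimes> d \<oplus> c \<otimes> b) (b \<otimes> d)"
    if "(x, y) \<in> frac_of R a b" "(z, w) \<in> frac_of R c d" for x y z w
  proof -
    note xy = mem_frac_ofD[OF a b that(1)] and zw = mem_frac_ofD[OF c d that(2)]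
    have "(x \<otimes> w \<oplus> z \<otimes> y) \<otimes> (b \<otimes> d) = (x \<otimes> b) \<otimes> (w \<otimes> d) \<oplus> (z \<otimes> d) \<otimes> (y \<otimes> b)"
      using a b c d xy(1,2) zw(1,2) by (simp add: m_ac l_distr r_distr)
    also have "\<dots> = (a \<otimes> y) \<otimes> (w \<otimes> d) \<oplus> (c \<otimes> w) \<otimes> (y \<otimes> b)" using xy zw by simp
    also have "\<dots> = (a \<otimes> d \<oplus> c \<otimes> b) \<otimes> (y \<otimes> w)"
      using a b c d xy(1,2) zw(1,2) by (simp add: m_ac l_distr r_distr)
    finally show ?thesis
      using a b c d xy(1,2) zw(1,2) mult_nonzero[OF b d] mult_nonzero[OF xy(2) zw(2)]
      by (subst frac_of_eq_iff) auto
  qed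
  then have "(\<Union>(x, y)\<in>frac_of R a b. \<Union>(z, w)\<in>frac_of R c d. frac_of R (x \<otimes> w \<oplus> z \<otimes> y) (y \<otimes> w))
      = (\<Union>p\<in>frac_of R a b. \<Union>q\<in>frac_of R c d. frac_of R (a \<otimes> d \<oplus> c \<otimes> b) (b \<otimes> d))"
    by (intro SUP_cong refl) (auto split: prod.splits)
  also have "\<dots> = frac_of R (a \<otimes> d \<oplus> c \<otimes> b) (b \<otimes> d)"
    using frac_of_self[OF a b] frac_of_self[OF c d] by blast
  finally show ?thesis by (simp add: quotient_field_def)
qed

lemma quotient_field_one: "\<one>\<^bsub>quotient_field R\<^esub> = frac_of R \<one> \<one>"
  and quotient_field_zero: "\<zero>\<^bsub>quotient_field R\<^esub> = frac_of R \<zero> \<one>"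
  by (simp_all add: quotient_field_def)

lemma quotient_field_memI:
  "a \<in> carrier R \<Longrightarrow> b \<in> carrier R - {\<zero>} \<Longrightarrow> frac_of R a b \<in> carrier (quotient_field R)"
  by (auto simp: quotient_field_def)

lemma quotient_field_memE:
  assumes "U \<in> carrier (quotient_field R)"
  obtains a b where "a \<in> carrier R" "b \<in> carrier R" "b \<noteq> \<zero>" "U = frac_of R a b"
  using assms by (auto simp: quotient_field_def)

theorem field_quotient_field: "field (quotient_field R)"
proof -
  let ?Q = "quotient_field R"
  note qf = quotient_field_mult quotient_field_add quotient_field_one quotient_field_zero
    frac_of_eq_iff quotient_field_memI
  have nz: "b \<otimes> d \<noteq> \<zero>" if "b \<in> carrier R" "d \<in> carrier R" "b \<noteq> \<zero>" "d \<noteq> \<zero>" for b d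
    using that integral by auto
  have "cring ?Q"
  proof (rule cringI)
    show "abelian_group ?Q"
    proof (rule abelian_groupI)
      fix U assume U: "U \<in> carrier ?Q"
      then obtain a b where ab: "a \<in> carrier R" "b \<in> carrier R" "b \<noteq> \<zero>" "U = frac_of R a b"
        by (rule quotient_field_memE)
      show "\<zero>\<^bsub>?Q\<^esub> \<oplus>\<^bsub>?Q\<^esub> U = U" using ab by (simp add: qf nz)
      have "frac_of R (\<ominus> a) b \<oplus>\<^bsub>?Q\<^esub> U = \<zero>\<^bsub>?Q\<^esub>"
        using ab by (simp add: qf nz l_minus l_neg)
      with ab show "\<exists>V\<in>carrier ?Q. V \<oplus>\<^bsub>?Q\<^esub> U = \<zero>\<^bsub>?Q\<^esub>"
        by (intro bexI[of _ "frac_of R (\<ominus> a) b"]) (auto simp: qf)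
      fix V assume "V \<in> carrier ?Q"
      then obtain c d where cd: "c \<in> carrier R" "d \<in> carrier R" "d \<noteq> \<zero>" "V = frac_of R c d"
        by (rule quotient_field_memE)
      show "U \<oplus>\<^bsub>?Q\<^esub> V \<in> carrier ?Q" using ab cd by (simp add: qf nz)
      show "U \<oplus>\<^bsub>?Q\<^esub> V = V \<oplus>\<^bsub>?Q\<^esub> U" using ab cd by (simp add: qf nz m_ac a_ac)
      fix W assume "W \<in> carrier ?Q"
      then obtain e f where ef: "e \<in> carrier R" "f \<in> carrier R" "f \<noteq> \<zero>" "W = frac_of R e f"
        by (rule quotient_field_memE)
      show "U \<oplus>\<^bsub>?Q\<^esub> V \<oplus>\<^bsub>?Q\<^esub> W = U \<oplus>\<^bsub>?Q\<^esub> (V \<oplus>\<^bsub>?Q\<^esub> W)"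
        using ab cd ef by (simp add: qf nz m_ac l_distr r_distr a_ac)
    qed (simp add: qf)
    show "comm_monoid ?Q"
    proof (rule comm_monoidI)
      fix U V assume "U \<in> carrier ?Q" "V \<in> carrier ?Q"
      then obtain a b c d where ab: "a \<in> carrier R" "b \<in> carrier R" "b \<noteq> \<zero>" "U = frac_of R a b"
        and cd: "c \<in> carrier R" "d \<in> carrier R" "d \<noteq> \<zero>" "V = frac_of R c d"
        by (elim quotient_field_memE) blast
      show "U \<otimes>\<^bsub>?Q\<^esub> V \<in> carrier ?Q" using ab cd by (simp add: qf nz)
      show "U \<otimes>\<^bsub>?Q\<^esub> V = V \<otimes>\<^bsub>?Q\<^esub> U" using ab cd by (simp add: qf nz m_ac)
      show "\<one>\<^bsub>?Q\<^esub> \<otimes>\<^bsub>?Q\<^esub> U = U" using ab by (simp add: qf nz)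
      fix W assume "W \<in> carrier ?Q"
      then obtain e f where ef: "e \<in> carrier R" "f \<in> carrier R" "f \<noteq> \<zero>" "W = frac_of R e f"
        by (rule quotient_field_memE)
      show "U \<otimes>\<^bsub>?Q\<^esub> V \<otimes>\<^bsub>?Q\<^esub> W = U \<otimes>\<^bsub>?Q\<^esub> (V \<otimes>\<^bsub>?Q\<^esub> W)"
        using ab cd ef by (simp add: qf nz m_ac)
    qed (simp add: qf)
    fix U V W assume "U \<in> carrier ?Q" "V \<in> carrier ?Q" "W \<in> carrier ?Q"
    then obtain a b c d e f where
        "a \<in> carrier R" "b \<in> carrier R" "b \<noteq> \<zero>" "U = frac_of R a b"
        "c \<in> carrier R" "d \<in> carrier R" "d \<noteq> \<zero>" "V = frac_of R c d"
        "e \<in> carrier R" "f \<in> carrier R" "f \<noteq> \<zero>" "W = frac_of R e f"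
      by (elim quotient_field_memE) blast
    then show "(U \<oplus>\<^bsub>?Q\<^esub> V) \<otimes>\<^bsub>?Q\<^esub> W = U \<otimes>\<^bsub>?Q\<^esub> W \<oplus>\<^bsub>?Q\<^esub> V \<otimes>\<^bsub>?Q\<^esub> W"
      by (simp add: qf nz m_ac l_distr r_distr)
  qed
  then show ?thesis
  proof (rule cring.cring_fieldI2)
    show "\<zero>\<^bsub>?Q\<^esub> \<noteq> \<one>\<^bsub>?Q\<^esub>" by (simp add: qf)
    fix U assume U: "U \<in> carrier ?Q" "U \<noteq> \<zero>\<^bsub>?Q\<^esub>"
    then obtain a b where ab: "a \<in> carrier R" "b \<in> carrier R" "b \<noteq> \<zero>" "U = frac_of R a b"
      by (elim quotient_field_memE) blast
    with U have "a \<noteq> \<zero>" by (auto simp: qf)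
    with ab show "\<exists>V\<in>carrier ?Q. U \<otimes>\<^bsub>?Q\<^esub> V = \<one>\<^bsub>?Q\<^esub>"
      by (intro bexI[of _ "frac_of R b a"]) (auto simp: qf nz m_ac)
  qed
qed

theorem subring_localization:
  assumes M: "submonoid M R" "\<zero> \<notin> M"
  shows "subring (carrier (localization R M)) (quotient_field R)"
proof -
  let ?Q = "quotient_field R"
  interpret Q: field ?Q by (rule field_quotient_field)
  have MR: "s \<in> carrier R - {\<zero>}" if "s \<in> M" for s
    using that M submonoid.mem_carrier[OF M(1)] by auto
  have Mm: "s \<otimes> s' \<in> M" if "s \<in> M" "s' \<in> M" for s s'
    using that submonoid.m_closed[OF M(1)] by auto
  have L: "carrier (localization R M) = {frac_of R a s | a s. a \<in> carrier R \<and> s \<in> M}"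
    by (simp add: localization_def)
  have neg: "\<ominus>\<^bsub>?Q\<^esub> frac_of R a s = frac_of R (\<ominus> a) s" if "a \<in> carrier R" "s \<in> M" for a s
    using that MR[of s] mult_nonzero[of s s]
    by (intro Q.minus_equality)
      (simp_all add: quotient_field_add quotient_field_zero quotient_field_memI frac_of_eq_iff
        l_minus l_neg)
  show ?thesis
  proof (rule Q.subringI)
    show "carrier (localization R M) \<subseteq> carrier ?Q"
      unfolding L using MR by (auto intro!: quotient_field_memI)
    show "\<one>\<^bsub>?Q\<^esub> \<in> carrier (localization R M)"
      unfolding L quotient_field_one using submonoid.one_closed[OF M(1)] by blast
    fix U assume "U \<in> carrier (localization R M)"
    then obtain a s where a: "a \<in> carrier R" "s \<in> M" "U = frac_of R a s" unfolding L by blast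
    show "\<ominus>\<^bsub>?Q\<^esub> U \<in> carrier (localization R M)"
      unfolding L a(3) neg[OF a(1,2)] using a by blast
    fix V assume "V \<in> carrier (localization R M)"
    then obtain c u where c: "c \<in> carrier R" "u \<in> M" "V = frac_of R c u" unfolding L by blast
    have "a \<otimes> c \<in> carrier R" "a \<otimes> u \<oplus> c \<otimes> s \<in> carrier R"
      using a c MR by auto
    then show "U \<otimes>\<^bsub>?Q\<^esub> V \<in> carrier (localization R M)"
      and "U \<oplus>\<^bsub>?Q\<^esub> V \<in> carrier (localization R M)"
      unfolding L a(3) c(3) quotient_field_mult[OF a(1) MR[OF a(2)] c(1) MR[OF c(2)]]
        quotient_field_add[OF a(1) MR[OF a(2)] c(1) MR[OF c(2)]]
      using Mm[OF a(2) c(2)] by blast+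
  qed
qed

end

end

theory Submission
  imports Defs
begin

text \<open>
  Write \<open>x \<preceq> y\<close> for \<open>dvd_power R x y\<close>: \<open>x\<close> divides some power of \<open>y\<close>. The localizations
  $R_{\mathfrak p}$ and $R_t$ agree iff $t \notin \mathfrak p$ and every \<open>s\<close> outside $\mathfrak p$ satisfies \<open>s \<preceq> t\<close>
  (\<open>principal_quotient_ring_at_prime_iff\<close>), so being locally pqr means that the complement of
  every prime has a greatest element for \<open>\<preceq>\<close> (\<open>locally_pqr_iff\<close>).

  Let $A = R^G$ and let $\mathfrak p$ be a prime of $A$. An ideal $P$ of $R$ that is maximal among
  those disjoint from $A \setminus \mathfrak p$ is prime and lies over $\mathfrak p$
  (\<open>lying_over_fixed\<close>); this is where finite orbits first enter, since they give every element of
  $R$ a norm in $A$, the product of its orbit. Let $t$ be greatest outside $P$. Its conjugates are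
  greatest outside the corresponding conjugates of $P$, but a product of conjugates may well lie in
  $P$, so the norm of $t$ is of no use. Instead one forms
  \[ f = \sum_{T} \prod_{\tau \in T} \tau, \]
  where $T$ ranges over the classes of the orbit of $t$ under the equivalence associated with
  \<open>\<preceq>\<close>; the classes correspond to the conjugates of $P$.

  The element $f$ is fixed because $G$ permutes the classes (\<open>orbit_class_sum_fixed\<close>). It lies
  outside $P$ (\<open>orbit_class_sum_notin\<close>): different conjugates of $P$ are incomparable
  (\<open>dvd_power_conjugate_sym\<close>), so every class but that of $t$ is contained in $P$, while the class of $t$ avoids $P$. Finally, an element
  $a \in A \setminus \mathfrak p$ satisfies \<open>a \<preceq> t\<close>, hence \<open>a \<preceq> \<tau>\<close> for every conjugate $\tau$ of
  $t$, hence \<open>a \<preceq> f\<close>, as the radical of $aR$ is an ideal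
  (\<open>dvd_power_orbit_class_sum\<close>). The cofactor in this last divisibility
  is fixed since $R$ is a domain, so $f$ is greatest in $A \setminus \mathfrak p$.
\<close>

section \<open>Prime ideals and finite products\<close>

text \<open>
  Zorn's lemma gives an ideal maximal among those that contain \<open>I\<close> and avoid \<open>S\<close>. The last clause
  is its maximality: the ideal generated by \<open>P\<close> and an element outside \<open>P\<close> meets \<open>S\<close>. Both
  primality and the lying-over argument below are drawn from it.
\<close>

lemma (in cring) ex_prime_maximal_disjoint:
  assumes I: "ideal I R" and disj: "I \<inter> S = {}"
    and one: "\<one> \<in> S" and mult: "\<And>x y. x \<in> S \<Longrightarrow> y \<in> S \<Longrightarrow> x \<otimes> y \<in> S"
  obtains P where "primeideal P R" "I \<subseteq> P" "P \<inter> S = {}"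
    "\<And>a. a \<in> carrier R \<Longrightarrow> a \<notin> P \<Longrightarrow> \<exists>p\<in>P. \<exists>c\<in>carrier R. p \<oplus> c \<otimes> a \<in> S"
proof -
  define \<A> where "\<A> = {J. ideal J R \<and> I \<subseteq> J \<and> J \<inter> S = {}}"
  have "\<exists>P\<in>\<A>. \<forall>J\<in>\<A>. P \<subseteq> J \<longrightarrow> J = P"
  proof (rule subset_Zorn_nonempty)
    show "\<A> \<noteq> {}" using I disj by (auto simp: \<A>_def)
    fix \<C> assume ne: "\<C> \<noteq> {}" and c: "subset.chain \<A> \<C>"
    have "subset.chain {J. ideal J R} \<C>"
      using c by (auto simp: pred_on.chain_def \<A>_def)
    from chain_Union_is_ideal[OF this] ne have "ideal (\<Union>\<C>) R" by simp
    then show "\<Union>\<C> \<in> \<A>" using ne c by (fastforce simp: pred_on.chain_def \<A>_def)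
  qed
  then obtain P where "P \<in> \<A>" and max: "\<forall>J\<in>\<A>. P \<subseteq> J \<longrightarrow> J = P" by blast
  then have P: "ideal P R" "I \<subseteq> P" "P \<inter> S = {}" by (simp_all add: \<A>_def)
  have maxP: "J \<inter> S \<noteq> {}" if "ideal J R" "P \<subset> J" for J
  proof
    assume "J \<inter> S = {}"
    with that P(2) have "J \<in> \<A>" by (auto simp: \<A>_def)
    with max that(2) show False by blast
  qed
  interpret P: ideal P R by (rule P(1))
  have meets: "\<exists>p\<in>P. \<exists>c\<in>carrier R. p \<oplus> c \<otimes> a \<in> S" if a: "a \<in> carrier R" "a \<notin> P" for a
  proof -
    have idl: "ideal (P <+>\<^bsub>R\<^esub> PIdl a) R" by (rule add_ideals[OF P(1) cgenideal_ideal[OF a(1)]])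
    have sum_mem: "p \<oplus> k \<in> P <+>\<^bsub>R\<^esub> PIdl a" if "p \<in> P" "k \<in> PIdl a" for p k
      using that by (auto simp: set_add_def')
    have "P \<subset> P <+>\<^bsub>R\<^esub> PIdl a"
    proof
      show "P \<subseteq> P <+>\<^bsub>R\<^esub> PIdl a"
      proof
        fix x assume "x \<in> P"
        moreover have "\<zero> \<in> PIdl a"
          by (rule additive_subgroup.zero_closed[OF ideal.axioms(1)[OF cgenideal_ideal[OF a(1)]]])
        ultimately show "x \<in> P <+>\<^bsub>R\<^esub> PIdl a"
          using sum_mem[of x \<zero>] P.Icarr[of x] by simp
      qed
      have "a \<in> P <+>\<^bsub>R\<^esub> PIdl a"
        using sum_mem[OF P.zero_closed cgenideal_self[OF a(1)]] a(1) by simp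
      then show "P \<noteq> P <+>\<^bsub>R\<^esub> PIdl a" using a(2) by blast
    qed
    with idl have "(P <+>\<^bsub>R\<^esub> PIdl a) \<inter> S \<noteq> {}" by (rule maxP)
    then show ?thesis by (auto simp: set_add_def' cgenideal_def)
  qed
  have "primeideal P R"
  proof (rule primeidealI[OF P(1) is_cring])
    show "carrier R \<noteq> P" using one P(3) by blast
    fix a b assume ab: "a \<in> carrier R" "b \<in> carrier R" "a \<otimes> b \<in> P"
    show "a \<in> P \<or> b \<in> P"
    proof (rule ccontr)
      assume "\<not> (a \<in> P \<or> b \<in> P)"
      then obtain p c q d where p: "p \<in> P" "c \<in> carrier R" "p \<oplus> c \<otimes> a \<in> S"
        and q: "q \<in> P" "d \<in> carrier R" "q \<oplus> d \<otimes> b \<in> S"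
        using meets[of a] meets[of b] ab(1,2) by blast
      have "(p \<oplus> c \<otimes> a) \<otimes> (q \<oplus> d \<otimes> b)
          = (p \<otimes> (q \<oplus> d \<otimes> b) \<oplus> (c \<otimes> a) \<otimes> q) \<oplus> (c \<otimes> d) \<otimes> (a \<otimes> b)"
        using ab p q P.Icarr[OF p(1)] P.Icarr[OF q(1)]
        by (simp add: l_distr r_distr m_ac a_ac)
      also have "\<dots> \<in> P"
        using ab p q P.Icarr[OF p(1)] P.Icarr[OF q(1)]
        by (intro P.a_closed P.I_l_closed[of q] P.I_l_closed[of "a \<otimes> b"] P.I_r_closed[of p]) auto
      finally show False using mult[OF p(3) q(3)] P(3) by blast
    qed
  qed
  with P meets show ?thesis using that by blast
qed

lemma (in primeideal) one_notin: "\<one> \<notin> I"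
  using one_imp_carrier I_notcarr by blast

lemma (in primeideal) nat_pow_mem_imp_mem:
  "x \<in> carrier R \<Longrightarrow> x [^] (n :: nat) \<in> I \<Longrightarrow> x \<in> I"
proof (induction n)
  case (Suc n)
  then show ?case using I_prime[of "x [^] n" x] by auto
qed (use one_notin in simp)

lemma (in ideal) finsum_mem:
  "finite B \<Longrightarrow> (\<And>b. b \<in> B \<Longrightarrow> g b \<in> I) \<Longrightarrow> (\<Oplus>b\<in>B. g b) \<in> I"
  by (induction B rule: finite_induct) (auto simp: Icarr Pi_def)

lemma (in primeideal) finprod_mem_iff:
  assumes "finite B" "B \<subseteq> carrier R"
  shows "(\<Otimes>b\<in>B. b) \<in> I \<longleftrightarrow> B \<inter> I \<noteq> {}"
  using assms
proof (induction B rule: finite_induct)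
  case (insert x B)
  have "(\<Otimes>b\<in>B. b) \<in> carrier R" using insert by (intro finprod_closed) auto
  moreover have "(\<Otimes>b\<in>insert x B. b) = x \<otimes> (\<Otimes>b\<in>B. b)"
    using insert by (intro finprod_insert) auto
  ultimately show ?case
    using insert I_prime[of x "\<Otimes>b\<in>B. b"] I_l_closed I_r_closed by auto
qed (use one_notin in simp)

lemma (in cring) finprod_congruent:
  assumes "finite Y" "a \<in> carrier R" "x \<in> carrier R"
    and "Y \<subseteq> carrier R" "\<And>y. y \<in> Y \<Longrightarrow> \<exists>r\<in>carrier R. y = a \<oplus> x \<otimes> r"
  shows "\<exists>z\<in>carrier R. (\<Otimes>y\<in>Y. y) = a [^] card Y \<oplus> x \<otimes> z"
  using assms
proof (induction Y rule: finite_induct)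
  case empty
  then show ?case by (auto intro!: bexI[of _ \<zero>])
next
  case (insert y Y)
  then obtain z r where z: "z \<in> carrier R" "(\<Otimes>y\<in>Y. y) = a [^] card Y \<oplus> x \<otimes> z"
    and r: "r \<in> carrier R" "y = a \<oplus> x \<otimes> r" by (metis insert_iff insert_subset)
  have "(\<Otimes>b\<in>insert y Y. b) = y \<otimes> (\<Otimes>b\<in>Y. b)"
    using insert by (intro finprod_insert) auto
  also have "\<dots> = a [^] card (insert y Y) \<oplus> x \<otimes> (a \<otimes> z \<oplus> r \<otimes> (a [^] card Y \<oplus> x \<otimes> z))"
    using insert z r by (simp add: l_distr r_distr m_ac a_ac)
  finally show ?case by (rule bexI) (use insert.prems z r in auto)
qed

section \<open>Divisibility up to powers\<close>

definition dvd_power :: "('a, 'm) ring_scheme \<Rightarrow> 'a \<Rightarrow> 'a \<Rightarrow> bool"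
  where "dvd_power R x y \<longleftrightarrow> (\<exists>n :: nat. x divides\<^bsub>R\<^esub> (y [^]\<^bsub>R\<^esub> n))"

lemma (in cring) dvd_power_refl: "x \<in> carrier R \<Longrightarrow> dvd_power R x x"
  unfolding dvd_power_def by (rule exI[of _ 1]) auto

lemma (in cring) dvd_power_trans:
  assumes "dvd_power R x y" "dvd_power R y z"
    and x: "x \<in> carrier R" and "y \<in> carrier R" and z: "z \<in> carrier R"
  shows "dvd_power R x z"
proof -
  obtain m n :: nat and c d
    where c: "y [^] m = x \<otimes> c" "c \<in> carrier R" and d: "z [^] n = y \<otimes> d" "d \<in> carrier R"
    using assms(1,2) unfolding dvd_power_def factor_def by blast
  have "z [^] (n * m) = (y \<otimes> d) [^] m" using z by (simp add: nat_pow_pow[symmetric] d(1))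
  also have "\<dots> = x \<otimes> (c \<otimes> d [^] m)"
    using assms c d by (simp add: nat_pow_distrib m_assoc)
  finally show ?thesis
    using c d unfolding dvd_power_def factor_def by blast
qed

text \<open>
  This is the fact that the radical of a principal ideal is the intersection of the primes
  containing it; it lets divisibility of a power of a sum or product be read off termwise.
\<close>

lemma (in cring) dvd_powerI_prime:
  assumes a: "a \<in> carrier R" and f: "f \<in> carrier R"
    and prime: "\<And>Q. primeideal Q R \<Longrightarrow> a \<in> Q \<Longrightarrow> f \<in> Q"
  shows "dvd_power R a f"
proof (rule ccontr)
  assume not: "\<not> dvd_power R a f"
  let ?S = "range (\<lambda>n :: nat. f [^] n)"
  obtain Q where Q: "primeideal Q R" "PIdl a \<subseteq> Q" "Q \<inter> ?S = {}"
  proof (rule ex_prime_maximal_disjoint[OF cgenideal_ideal[OF a], of ?S])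
    have "f [^] n \<noteq> c \<otimes> a" if "c \<in> carrier R" for n :: nat and c
      using not that a unfolding dvd_power_def factor_def by (metis m_comm)
    then show "PIdl a \<inter> ?S = {}" by (auto simp: cgenideal_def)
    show "\<one> \<in> ?S" using rangeI[of "\<lambda>n :: nat. f [^] n" 0] by simp
    show "x \<otimes> y \<in> ?S" if "x \<in> ?S" "y \<in> ?S" for x y
      using that f by (auto simp: nat_pow_mult)
  qed
  from prime[OF Q(1)] Q(2) cgenideal_self[OF a] have "f \<in> Q" by blast
  moreover have "f \<in> ?S" using rangeI[of "\<lambda>n :: nat. f [^] n" 1] f by simp
  ultimately show False using Q(3) by blast
qed

lemma (in primeideal) dvd_power_mem:
  assumes "dvd_power R a x" "a \<in> I" "x \<in> carrier R"
  shows "x \<in> I"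
proof -
  obtain n :: nat and c where "c \<in> carrier R" "x [^] n = a \<otimes> c"
    using assms(1) unfolding dvd_power_def factor_def by blast
  then have "x [^] n \<in> I" using I_r_closed[OF assms(2)] by simp
  then show ?thesis by (rule nat_pow_mem_imp_mem[OF assms(3)])
qed

lemma (in domain) inverse_mem_localization_iff:
  assumes x: "x \<in> carrier R" "x \<noteq> \<zero>" and M: "M \<subseteq> carrier R - {\<zero>}"
  shows "frac_of R \<one> x \<in> carrier (localization R M) \<longleftrightarrow> (\<exists>s\<in>M. x divides s)"
proof -
  have eq_iff: "frac_of R \<one> x = frac_of R b s \<longleftrightarrow> s = x \<otimes> b" if b: "b \<in> carrier R" and s: "s \<in> M" for b s
  proof -
    have s': "s \<in> carrier R - {\<zero>}" using s M by blast
    then show ?thesis using frac_of_eq_iff[OF one_closed _ b s', of x] b x by (simp add: m_comm)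
  qed
  have "frac_of R \<one> x \<in> carrier (localization R M) \<longleftrightarrow>
      (\<exists>b s. b \<in> carrier R \<and> s \<in> M \<and> frac_of R \<one> x = frac_of R b s)"
    unfolding localization_def by simp metis
  also have "\<dots> \<longleftrightarrow> (\<exists>b s. b \<in> carrier R \<and> s \<in> M \<and> s = x \<otimes> b)"
    by (simp only: eq_iff cong: conj_cong)
  also have "\<dots> \<longleftrightarrow> (\<exists>s\<in>M. x divides s)" unfolding factor_def by blast
  finally show ?thesis .
qed

text \<open>
  $R_P \subseteq R_t$ says that the inverse of each \<open>s\<close> outside \<open>P\<close> has a power of \<open>t\<close> as a
  denominator, and $R_t \subseteq R_P$ says that \<open>t\<close> is invertible in $R_P$.
\<close>

lemma (in domain) principal_quotient_ring_at_prime_iff: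
  assumes P: "primeideal P R"
  shows "principal_quotient_ring (localization_at_prime R P) R \<longleftrightarrow>
    (\<exists>t\<in>carrier R - P. \<forall>s\<in>carrier R - P. dvd_power R s t)"
proof -
  interpret P: primeideal P R by (rule P)
  have zero: "\<zero> \<in> P" by (rule P.zero_closed)
  let ?pow = "\<lambda>t. {t [^] n | n :: nat. True}"
  have "localization R (carrier R - P) = localization R (?pow t) \<longleftrightarrow>
      t \<in> carrier R - P \<and> (\<forall>s\<in>carrier R - P. dvd_power R s t)"
    (is "?eq \<longleftrightarrow> ?max") if t: "t \<in> carrier R" "t \<noteq> \<zero>" for t
  proof
    have "t [^] n \<noteq> \<zero>" for n :: nat
    proof (induction n)
      case (Suc n)
      then show ?case using t integral[of "t [^] n" t] by auto
    qed simp
    then have pow: "?pow t \<subseteq> carrier R - {\<zero>}" using t by auto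
    have compl: "carrier R - P \<subseteq> carrier R - {\<zero>}" using zero by blast
    assume eq: ?eq
    have "t \<in> ?pow t" by (intro CollectI exI[of _ "1 :: nat"]) (simp add: t)
    then have "frac_of R \<one> t \<in> carrier (localization R (?pow t))"
      using inverse_mem_localization_iff[OF t pow] t by blast
    then obtain s where s: "s \<in> carrier R - P" "t divides s"
      using inverse_mem_localization_iff[OF t compl] unfolding eq by blast
    then have tP: "t \<notin> P" using P.I_r_closed unfolding factor_def by blast
    have "dvd_power R s t" if s: "s \<in> carrier R - P" for s
    proof -
      have s': "s \<in> carrier R" "s \<noteq> \<zero>" using s zero by auto
      have "frac_of R \<one> s \<in> carrier (localization R (carrier R - P))"
        using inverse_mem_localization_iff[OF s' compl] s by blast
      then show ?thesis
        using inverse_mem_localization_iff[OF s' pow] unfolding eq dvd_power_def by blast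
    qed
    with tP t show ?max by blast
  next
    assume max: ?max
    have pow: "t [^] n \<in> carrier R - P" for n :: nat
      using max P.nat_pow_mem_imp_mem[of t n] by auto
    have "frac_of R a s \<in> {frac_of R a s | a s. a \<in> carrier R \<and> s \<in> ?pow t}"
      if a: "a \<in> carrier R" and s: "s \<in> carrier R - P" for a s
    proof -
      from max s obtain n :: nat and c where c: "t [^] n = s \<otimes> c" "c \<in> carrier R"
        unfolding dvd_power_def factor_def by blast
      have "frac_of R a s = frac_of R (a \<otimes> c) (t [^] n)"
        using a s c pow[of n] zero by (subst frac_of_eq_iff) (auto simp: m_ac)
      moreover have "a \<otimes> c \<in> carrier R" using a c(2) by simp
      ultimately show ?thesis by blast
    qed
    then have "{frac_of R a s | a s. a \<in> carrier R \<and> s \<in> carrier R - P}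
        \<subseteq> {frac_of R a s | a s. a \<in> carrier R \<and> s \<in> ?pow t}"
      by (intro subsetI) (elim CollectE exE conjE, simp only:)
    moreover have "{frac_of R a s | a s. a \<in> carrier R \<and> s \<in> ?pow t}
        \<subseteq> {frac_of R a s | a s. a \<in> carrier R \<and> s \<in> carrier R - P}"
    proof (intro subsetI)
      fix U assume "U \<in> {frac_of R a s | a s. a \<in> carrier R \<and> s \<in> ?pow t}"
      then obtain a n where "U = frac_of R a (t [^] (n :: nat))" "a \<in> carrier R" by auto
      then show "U \<in> {frac_of R a s | a s. a \<in> carrier R \<and> s \<in> carrier R - P}"
        using pow[of n] by (intro CollectI exI conjI)
    qed
    ultimately have "{frac_of R a s | a s. a \<in> carrier R \<and> s \<in> carrier R - P}
        = {frac_of R a s | a s. a \<in> carrier R \<and> s \<in> ?pow t}"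
      by (rule subset_antisym)
    then show ?eq unfolding localization_def by (rule arg_cong)
  qed
  then show ?thesis
    using zero unfolding principal_quotient_ring_def localization_at_prime_def by blast
qed

lemma (in domain) locally_pqr_iff:
  "locally_pqr R \<longleftrightarrow>
    (\<forall>P. primeideal P R \<longrightarrow> (\<exists>t\<in>carrier R - P. \<forall>s\<in>carrier R - P. dvd_power R s t))"
  using domain_axioms principal_quotient_ring_at_prime_iff unfolding locally_pqr_def by blast

section \<open>Orbits and norms\<close>

locale locally_finite_automorphisms = domain R for R (structure) +
  fixes G :: "('a \<Rightarrow> 'a) set"
  assumes subgroup_G: "subgroup G (RingAutoGroup R)"
    and locally_finite: "locally_finite_action R G"
begin

definition orbit :: "'a \<Rightarrow> 'a set" where "orbit r = (\<lambda>g. g r) ` G"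

definition fixed :: "'a set" where "fixed = {r \<in> carrier R. \<forall>g\<in>G. g r = r}"

lemma ring_hom_cring_G: "g \<in> G \<Longrightarrow> ring_hom_cring R R g"
  and bij_betw_G: "g \<in> G \<Longrightarrow> bij_betw g (carrier R) (carrier R)"
proof -
  assume "g \<in> G"
  then have s: "g \<in> ring_auto R"
    using subgroup.subset[OF subgroup_G] by (auto simp: RingAutoGroup_def)
  then show "bij_betw g (carrier R) (carrier R)" by (simp add: ring_auto_def Bij_def)
  from s have "g \<in> ring_hom R R" by (simp add: ring_auto_def ring_iso_def)
  then show "ring_hom_cring R R g"
    by (intro ring_hom_cringI ring_hom_ringI2 ring_axioms is_cring)
qed

lemma G_closed: "g \<in> G \<Longrightarrow> x \<in> carrier R \<Longrightarrow> g x \<in> carrier R"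
  using bij_betw_G by (auto simp: bij_betw_def)

lemma inj_on_G: "g \<in> G \<Longrightarrow> inj_on g (carrier R)"
  using bij_betw_G by (auto simp: bij_betw_def)

lemma finite_orbit: "r \<in> carrier R \<Longrightarrow> finite (orbit r)"
  using locally_finite by (simp add: locally_finite_action_def orbit_def Setcompr_eq_image)

lemma orbit_subset: "r \<in> carrier R \<Longrightarrow> orbit r \<subseteq> carrier R"
  using G_closed by (auto simp: orbit_def)

lemma orbit_self: "r \<in> carrier R \<Longrightarrow> r \<in> orbit r"
  using subgroup.one_closed[OF subgroup_G]
  by (auto simp: orbit_def RingAutoGroup_def BijGroup_def intro!: image_eqI[of _ _ "\<lambda>x\<in>carrier R. x"])

lemma orbit_stable:
  assumes r: "r \<in> carrier R" and s: "g \<in> G" and y: "y \<in> orbit r"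
  shows "g y \<in> orbit r"
proof -
  from y obtain \<tau> where t: "\<tau> \<in> G" "y = \<tau> r" by (auto simp: orbit_def)
  have B: "\<rho> \<in> Bij (carrier R)" if "\<rho> \<in> G" for \<rho>
    using that subgroup.subset[OF subgroup_G] by (auto simp: RingAutoGroup_def ring_auto_def)
  have "compose (carrier R) g \<tau> \<in> G"
    using subgroup.m_closed[OF subgroup_G s t(1)] B[OF s] B[OF t(1)]
    by (simp add: RingAutoGroup_def BijGroup_def)
  then have "compose (carrier R) g \<tau> r \<in> orbit r" unfolding orbit_def by (rule imageI)
  then show ?thesis using r t by (simp add: compose_def)
qed

lemma image_orbit:
  assumes r: "r \<in> carrier R" and s: "g \<in> G"
  shows "g ` orbit r = orbit r"
  using orbit_stable[OF r s] inj_on_subset[OF inj_on_G[OF s] orbit_subset[OF r]]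
  by (intro endo_inj_surj[OF finite_orbit[OF r]]) auto

lemma fixed_carrier: "x \<in> fixed \<Longrightarrow> x \<in> carrier R"
  and fixed_by_G: "x \<in> fixed \<Longrightarrow> g \<in> G \<Longrightarrow> g x = x"
  by (simp_all add: fixed_def)

lemma subring_fixed: "subring fixed R"
proof (rule subringI)
  fix h assume h: "h \<in> fixed"
  have "g (\<ominus> h) = \<ominus> h" if "g \<in> G" for g
  proof -
    interpret s: ring_hom_cring R R g by (rule ring_hom_cring_G[OF that])
    show ?thesis using fixed_carrier[OF h] fixed_by_G[OF h that] by simp
  qed
  then show "\<ominus> h \<in> fixed" using h by (simp add: fixed_def)
  fix k assume k: "k \<in> fixed"
  have "g (h \<otimes> k) = h \<otimes> k \<and> g (h \<oplus> k) = h \<oplus> k" if "g \<in> G" for g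
  proof -
    interpret s: ring_hom_cring R R g by (rule ring_hom_cring_G[OF that])
    show ?thesis
      using fixed_carrier[OF h] fixed_by_G[OF h that] fixed_carrier[OF k] fixed_by_G[OF k that] by simp
  qed
  then show "h \<otimes> k \<in> fixed" "h \<oplus> k \<in> fixed" using h k by (simp_all add: fixed_def)
next
  have "g \<one> = \<one>" if "g \<in> G" for g
  proof -
    interpret s: ring_hom_cring R R g by (rule ring_hom_cring_G[OF that])
    show ?thesis by simp
  qed
  then show "\<one> \<in> fixed" by (simp add: fixed_def)
qed (auto simp: fixed_def)

lemma fixed_ring_eq: "fixed_ring R G = R\<lparr>carrier := fixed\<rparr>"
  by (simp add: fixed_ring_def fixed_def)

lemma domain_fixed: "domain (R\<lparr>carrier := fixed\<rparr>)"
  by (rule subring_is_domain[OF subring_fixed])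

lemma orbit_prod_fixed:
  assumes r: "r \<in> carrier R"
  shows "(\<Otimes>y\<in>orbit r. y) \<in> fixed"
proof -
  have "g (\<Otimes>y\<in>orbit r. y) = (\<Otimes>y\<in>orbit r. y)" if s: "g \<in> G" for g
  proof -
    interpret s: ring_hom_cring R R g by (rule ring_hom_cring_G[OF s])
    have "g (\<Otimes>y\<in>orbit r. y) = (\<Otimes>y\<in>orbit r. g y)"
      using orbit_subset[OF r] by (subst s.hom_finprod) (auto simp: o_def)
    also have "\<dots> = (\<Otimes>y\<in>g ` orbit r. y)"
      using orbit_subset[OF r] G_closed[OF s] inj_on_subset[OF inj_on_G[OF s]]
      by (subst finprod_reindex) auto
    finally show ?thesis by (simp only: image_orbit[OF r s])
  qed
  moreover have "(\<Otimes>y\<in>orbit r. y) \<in> carrier R"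
    using orbit_subset[OF r] by (intro finprod_closed) auto
  ultimately show ?thesis by (simp add: fixed_def)
qed

text \<open>An automorphism maps \<open>x z\<close> to \<open>x\<close> times the image of \<open>z\<close>, and \<open>x\<close> can be cancelled.\<close>

lemma fixed_cofactor:
  assumes "x \<in> fixed" "x \<noteq> \<zero>" "z \<in> carrier R" "x \<otimes> z \<in> fixed"
  shows "z \<in> fixed"
proof -
  have "g z = z" if s: "g \<in> G" for g
  proof -
    interpret s: ring_hom_cring R R g by (rule ring_hom_cring_G[OF s])
    have "x \<otimes> g z = g (x \<otimes> z)"
      using assms(3) fixed_carrier[OF assms(1)] fixed_by_G[OF assms(1) s] by simp
    also have "\<dots> = x \<otimes> z" by (rule fixed_by_G[OF assms(4) s])
    finally show ?thesis
      using assms(2,3) fixed_carrier[OF assms(1)] G_closed[OF s] m_lcancel by simp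
  qed
  then show ?thesis using assms by (simp add: fixed_def)
qed

lemma dvd_power_fixed:
  assumes "dvd_power R a f" "a \<in> fixed" "a \<noteq> \<zero>" "f \<in> fixed"
  shows "dvd_power (R\<lparr>carrier := fixed\<rparr>) a f"
proof -
  from assms(1) obtain n :: nat and c where c: "f [^] n = a \<otimes> c" "c \<in> carrier R"
    unfolding dvd_power_def factor_def by blast
  interpret A: domain "R\<lparr>carrier := fixed\<rparr>" by (rule domain_fixed)
  have "f [^] n \<in> fixed"
    using A.nat_pow_closed[of f n] assms(4) by (simp add: nat_pow_consistent[of f n fixed])
  then have "c \<in> fixed" using fixed_cofactor[OF assms(2,3) c(2)] c(1) by simp
  moreover have "f [^]\<^bsub>R\<lparr>carrier := fixed\<rparr>\<^esub> n = a \<otimes>\<^bsub>R\<lparr>carrier := fixed\<rparr>\<^esub> c"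
    using c(1) by (simp flip: nat_pow_consistent)
  ultimately show ?thesis
    unfolding dvd_power_def factor_def by auto
qed

section \<open>Lying over\<close>

text \<open>
  Suppose \<open>x \<in> p\<close> lies outside an ideal \<open>P\<close> maximal among those disjoint from \<open>A - p\<close>, where \<open>A\<close> is
  the fixed ring. Maximality gives \<open>y \<in> P\<close> and \<open>a \<in> A - p\<close> with $y \equiv a$ modulo $xR$. All
  conjugates of \<open>y\<close> are congruent to \<open>a\<close> as well, so the norm of \<open>y\<close> is a power of \<open>a\<close> up to a
  multiple \<open>x z\<close> of \<open>x\<close>. The norm is in $P \cap A \subseteq p$, and \<open>z\<close> is fixed, being the cofactor
  of \<open>x\<close> in a difference of fixed elements. Hence the power of \<open>a\<close> is in \<open>p\<close>, which is absurd.
\<close>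

lemma lying_over_fixed:
  assumes p: "primeideal p (R\<lparr>carrier := fixed\<rparr>)"
  obtains P where "primeideal P R" "P \<inter> fixed = p"
proof -
  let ?A = "R\<lparr>carrier := fixed\<rparr>"
  interpret p: primeideal p ?A by (rule p)
  have pA: "p \<subseteq> fixed" using p.a_subset by simp
  have zero_p: "\<zero> \<in> p" using additive_subgroup.zero_closed[OF p.additive_subgroup_axioms] by simp
  obtain P where P: "primeideal P R" "P \<inter> (fixed - p) = {}"
    and maxP: "\<And>x. x \<in> carrier R \<Longrightarrow> x \<notin> P \<Longrightarrow> \<exists>y\<in>P. \<exists>c\<in>carrier R. y \<oplus> c \<otimes> x \<in> fixed - p"
  proof (rule ex_prime_maximal_disjoint[of "{\<zero>}" "fixed - p"])
    show "ideal {\<zero>} R" by (rule zeroideal)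
    show "{\<zero>} \<inter> (fixed - p) = {}" using zero_p by simp
    show "\<one> \<in> fixed - p" using p.one_notin subringE(3)[OF subring_fixed] by simp
    show "x \<otimes> y \<in> fixed - p" if "x \<in> fixed - p" "y \<in> fixed - p" for x y
      using that p.I_prime[of x y] subringE(6)[OF subring_fixed] by auto
  qed blast
  interpret P: primeideal P R by (rule P(1))
  have "x \<in> P" if x: "x \<in> p" for x
  proof (rule ccontr)
    assume xP: "x \<notin> P"
    have xA: "x \<in> fixed" and xR: "x \<in> carrier R" using x pA fixed_carrier by auto
    have x0: "x \<noteq> \<zero>" using xP P.zero_closed by blast
    obtain y c where y: "y \<in> P" and c: "c \<in> carrier R" and a: "y \<oplus> c \<otimes> x \<in> fixed - p"
      using maxP[OF xR xP] by blast
    define a where "a = y \<oplus> c \<otimes> x"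
    have yR: "y \<in> carrier R" using y P.Icarr by blast
    have aA: "a \<in> fixed" "a \<notin> p" and aR: "a \<in> carrier R"
      using a fixed_carrier by (auto simp: a_def)
    have y_eq: "y = a \<oplus> x \<otimes> (\<ominus> c)"
      using yR c xR by (simp add: a_def r_minus m_comm a_assoc r_neg)
    have "\<exists>r\<in>carrier R. y' = a \<oplus> x \<otimes> r" if "y' \<in> orbit y" for y'
    proof -
      from that obtain g where s: "g \<in> G" "y' = g y" by (auto simp: orbit_def)
      interpret s: ring_hom_cring R R g by (rule ring_hom_cring_G[OF s(1)])
      have "y' = a \<oplus> x \<otimes> g (\<ominus> c)"
        using fixed_by_G[OF aA(1) s(1)] fixed_by_G[OF xA s(1)] aR xR c unfolding s(2)
        by (subst y_eq) (simp del: s.hom_a_inv)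
      then show ?thesis using c by auto
    qed
    then obtain z where z: "z \<in> carrier R"
        and N: "(\<Otimes>y\<in>orbit y. y) = a [^] card (orbit y) \<oplus> x \<otimes> z"
      using finprod_congruent[OF finite_orbit[OF yR] aR xR orbit_subset[OF yR]] by blast
    let ?N = "\<Otimes>y\<in>orbit y. y" and ?k = "card (orbit y)"
    have NA: "?N \<in> fixed" by (rule orbit_prod_fixed[OF yR])
    have "?N \<in> P"
      using P.finprod_mem_iff[OF finite_orbit[OF yR] orbit_subset[OF yR]] orbit_self[OF yR] y
      by blast
    with NA P(2) have Np: "?N \<in> p" by blast
    have akA: "a [^] ?k \<in> fixed"
      using p.nat_pow_closed[of a ?k] aA(1) by (simp add: nat_pow_consistent[of a ?k fixed])
    have akR: "a [^] ?k \<in> carrier R" using aR by simp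
    have xz: "x \<otimes> z = ?N \<oplus> \<ominus> (a [^] ?k)"
      unfolding N using akR xR z by (simp add: a_ac r_neg1 r_neg2 r_neg)
    have "x \<otimes> z \<in> fixed"
      unfolding xz using NA akA subringE(5,7)[OF subring_fixed] by blast
    then have zA: "z \<in> fixed" using fixed_cofactor[OF xA x0 z] by blast
    then have "x \<otimes> (\<ominus> z) \<in> p"
      using p.I_r_closed[of x "\<ominus> z"] x subringE(5)[OF subring_fixed] by simp
    then have "?N \<oplus> x \<otimes> (\<ominus> z) \<in> p"
      using additive_subgroup.a_closed[OF p.additive_subgroup_axioms] Np by simp
    moreover have "?N \<oplus> x \<otimes> (\<ominus> z) = a [^] ?k"
      unfolding N using akR xR z by (simp add: r_minus a_assoc r_neg)
    ultimately have "a [^] ?k \<in> p" by simp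
    then have "a \<in> p"
      using p.nat_pow_mem_imp_mem[of a ?k] aA(1) by (simp add: nat_pow_consistent[of a ?k fixed])
    with aA(2) show False by blast
  qed
  with P pA have "P \<inter> fixed = p" by blast
  with P(1) show ?thesis using that by blast
qed

section \<open>The sum of the class products of an orbit\<close>

lemma dvd_power_G_iff:
  assumes s: "g \<in> G" and x: "x \<in> carrier R" and y: "y \<in> carrier R"
  shows "dvd_power R (g x) (g y) \<longleftrightarrow> dvd_power R x y"
proof -
  interpret s: ring_hom_cring R R g by (rule ring_hom_cring_G[OF s])
  have pow: "g (y [^] n) = g y [^] n" for n :: nat
    by (induction n) (use y in auto)
  have "g x divides (g y [^] n) \<longleftrightarrow> x divides (y [^] n)" for n :: nat
  proof
    assume "g x divides (g y [^] n)"
    then obtain c where c: "c \<in> carrier R" "g y [^] n = g x \<otimes> c" unfolding factor_def by blast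
    from c(1) obtain d where d: "d \<in> carrier R" "c = g d"
      using bij_betw_G[OF s] by (auto simp: bij_betw_def)
    have "g (y [^] n) = g (x \<otimes> d)" using c d x by (simp add: pow)
    then have "y [^] n = x \<otimes> d" by (rule inj_onD[OF inj_on_G[OF s]]) (use x y d in auto)
    then show "x divides (y [^] n)" using d(1) unfolding factor_def by blast
  next
    assume "x divides (y [^] n)"
    then obtain d where d: "d \<in> carrier R" "y [^] n = x \<otimes> d" unfolding factor_def by blast
    then have "g y [^] n = g x \<otimes> g d" using x by (simp flip: pow)
    then show "g x divides (g y [^] n)" using d(1) unfolding factor_def by auto
  qed
  then show ?thesis unfolding dvd_power_def by blast
qed

text \<open>
  This is incomparability of distinct conjugates of a prime, in terms of \<open>dvd_power\<close>. The automorphism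
  maps the elements of the orbit below \<open>t\<close> injectively to those below \<open>g t\<close>. If \<open>g t\<close> is below
  \<open>t\<close>, the latter form a subset of the former; counting shows that both sets are equal, and \<open>t\<close>
  belongs to the first.
\<close>

lemma dvd_power_conjugate_sym:
  assumes t: "t \<in> carrier R" and y: "y \<in> orbit t" and le: "dvd_power R y t"
  shows "dvd_power R t y"
proof -
  from y obtain g where s: "g \<in> G" "y = g t" by (auto simp: orbit_def)
  let ?below = "\<lambda>z. {x \<in> orbit t. dvd_power R x z}"
  note O = orbit_subset[OF t]
  have yR: "y \<in> carrier R" using O y by blast
  have "g ` ?below t \<subseteq> ?below y"
    using orbit_stable[OF t s(1)] dvd_power_G_iff[OF s(1) _ t] O unfolding s(2) by blast
  moreover have sub: "?below y \<subseteq> ?below t"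
    using dvd_power_trans[OF _ le _ yR t] O by blast
  moreover have fin: "finite (?below t)" using finite_orbit[OF t] by simp
  moreover have "card (g ` ?below t) = card (?below t)"
    using O by (intro card_image inj_on_subset[OF inj_on_G[OF s(1)]]) blast
  ultimately have "?below y = ?below t"
    by (metis (no_types, lifting) card_mono card_seteq finite_subset)
  then show ?thesis using orbit_self[OF t] dvd_power_refl[OF t] by blast
qed

definition orbit_class :: "'a \<Rightarrow> 'a \<Rightarrow> 'a set"
  where "orbit_class t x = {y \<in> orbit t. dvd_power R x y \<and> dvd_power R y x}"

definition orbit_class_sum :: "'a \<Rightarrow> 'a"
  where "orbit_class_sum t = (\<Oplus>T\<in>orbit_class t ` orbit t. \<Otimes>y\<in>T. y)"

lemma orbit_class_self: "t \<in> carrier R \<Longrightarrow> x \<in> orbit t \<Longrightarrow> x \<in> orbit_class t x"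
  using orbit_subset dvd_power_refl by (auto simp: orbit_class_def)

lemma orbit_class_subset: "t \<in> carrier R \<Longrightarrow> orbit_class t x \<subseteq> carrier R"
  using orbit_subset by (auto simp: orbit_class_def)

lemma finite_orbit_class: "t \<in> carrier R \<Longrightarrow> finite (orbit_class t x)"
  using finite_orbit by (auto simp: orbit_class_def)

lemma orbit_class_eqI:
  assumes t: "t \<in> carrier R" and x: "x \<in> orbit t" and y: "y \<in> orbit_class t x"
  shows "orbit_class t y = orbit_class t x"
proof -
  have "x \<in> carrier R" "y \<in> carrier R" using x y orbit_subset[OF t] by (auto simp: orbit_class_def)
  with y orbit_subset[OF t] show ?thesis
    unfolding orbit_class_def using dvd_power_trans by blast
qed

lemma orbit_class_prod_closed:
  "t \<in> carrier R \<Longrightarrow> T \<in> orbit_class t ` orbit t \<Longrightarrow> (\<Otimes>y\<in>T. y) \<in> carrier R"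
  using orbit_class_subset[of t] by (intro finprod_closed) auto

lemma orbit_class_sum_closed: "t \<in> carrier R \<Longrightarrow> orbit_class_sum t \<in> carrier R"
  unfolding orbit_class_sum_def using orbit_class_prod_closed by (intro finsum_closed) auto

lemma image_orbit_class:
  assumes t: "t \<in> carrier R" and s: "g \<in> G" and x: "x \<in> orbit t"
  shows "g ` orbit_class t x = orbit_class t (g x)"
proof -
  note O = orbit_subset[OF t]
  have "orbit_class t (g x) = {y \<in> g ` orbit t. dvd_power R (g x) y \<and> dvd_power R y (g x)}"
    by (simp add: orbit_class_def image_orbit[OF t s])
  also have "\<dots> = g ` {y \<in> orbit t. dvd_power R (g x) (g y) \<and> dvd_power R (g y) (g x)}"
    by blast
  also have "\<dots> = g ` orbit_class t x"
    unfolding orbit_class_def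
    using dvd_power_G_iff[OF s] O x by (intro arg_cong[of _ _ "image g"]) blast
  finally show ?thesis by simp
qed

lemma orbit_class_sum_fixed:
  assumes t: "t \<in> carrier R"
  shows "orbit_class_sum t \<in> fixed"
proof -
  let ?C = "orbit_class t ` orbit t"
  have "g (orbit_class_sum t) = orbit_class_sum t" if s: "g \<in> G" for g
  proof -
    interpret s: ring_hom_cring R R g by (rule ring_hom_cring_G[OF s])
    \<comment> \<open>Automorphisms preserve \<open>dvd_power\<close>, so they permute the terms of the sum.\<close>
    have perm: "image g ` ?C = ?C"
    proof -
      have "image g ` ?C = orbit_class t ` (g ` orbit t)"
        unfolding image_image using image_orbit_class[OF t s] by simp
      then show ?thesis by (simp add: image_orbit[OF t s])
    qed
    have inj: "inj_on (image g) ?C"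
      using orbit_class_subset[OF t] inj_on_G[OF s]
      by (intro inj_onI) (metis image_iff inj_on_image_eq_iff)
    have prod: "g (\<Otimes>y\<in>T. y) = (\<Otimes>y\<in>g ` T. y)" if T: "T \<in> ?C" for T
    proof -
      have TR: "T \<subseteq> carrier R" using T orbit_class_subset[OF t] by blast
      have "g (\<Otimes>y\<in>T. y) = (\<Otimes>y\<in>T. g y)"
        using TR by (subst s.hom_finprod) (auto simp: o_def)
      also have "\<dots> = (\<Otimes>y\<in>g ` T. y)"
        using TR inj_on_subset[OF inj_on_G[OF s]] G_closed[OF s] by (subst finprod_reindex) auto
      finally show ?thesis .
    qed
    have "g (orbit_class_sum t) = (\<Oplus>T\<in>?C. g (\<Otimes>y\<in>T. y))"
      unfolding orbit_class_sum_def
      using orbit_class_prod_closed[OF t] by (subst s.hom_finsum) (auto simp: o_def)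
    also have "\<dots> = (\<Oplus>T\<in>?C. \<Otimes>y\<in>g ` T. y)"
    proof (rule finsum_cong'[OF refl _ prod])
      show "(\<lambda>T. \<Otimes>y\<in>g ` T. y) \<in> ?C \<rightarrow> carrier R"
      proof
        fix T assume "T \<in> ?C"
        then have "g ` T \<in> image g ` ?C" by (rule imageI)
        then show "(\<Otimes>y\<in>g ` T. y) \<in> carrier R"
          unfolding perm by (rule orbit_class_prod_closed[OF t])
      qed
    qed
    also have "\<dots> = (\<Oplus>T\<in>image g ` ?C. \<Otimes>y\<in>T. y)"
      using orbit_class_prod_closed[OF t] inj by (subst add.finprod_reindex) (auto simp: perm Pi_def)
    finally show ?thesis by (simp only: perm orbit_class_sum_def)
  qed
  then show ?thesis using orbit_class_sum_closed[OF t] by (simp add: fixed_def)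
qed

text \<open>
  Modulo \<open>P\<close> only the class of \<open>t\<close> contributes: a conjugate outside \<open>P\<close> is below \<open>t\<close>, and then
  incomparability puts it into the class of \<open>t\<close>.
\<close>

lemma orbit_class_sum_notin:
  assumes P: "primeideal P R" and t: "t \<in> carrier R - P"
    and max: "\<And>s. s \<in> carrier R - P \<Longrightarrow> dvd_power R s t"
  shows "orbit_class_sum t \<notin> P"
proof
  interpret P: primeideal P R by (rule P)
  have tR: "t \<in> carrier R" using t by simp
  note O = orbit_subset[OF tR]
  let ?C = "orbit_class t ` orbit t" and ?T = "orbit_class t t"
  have fin: "finite ?C" using finite_orbit[OF tR] by simp
  have TC: "?T \<in> ?C" using orbit_self[OF tR] by blast
  have outside: "y \<in> ?T" if "y \<in> orbit t" "y \<notin> P" for y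
    using that max[of y] dvd_power_conjugate_sym[OF tR that(1)] O by (auto simp: orbit_class_def)
  have other: "(\<Otimes>y\<in>T. y) \<in> P" if T: "T \<in> ?C - {?T}" for T
  proof -
    from T obtain x where x: "x \<in> orbit t" "T = orbit_class t x" by blast
    have "x \<notin> ?T" using T x(2) orbit_class_eqI[OF tR orbit_self[OF tR]] by blast
    then have "x \<in> P" using outside x(1) by blast
    then show ?thesis
      using P.finprod_mem_iff[of T] finite_orbit_class[OF tR] orbit_class_subset[OF tR]
        orbit_class_self[OF tR x(1)] x(2) by blast
  qed
  have rest: "(\<Oplus>T\<in>?C - {?T}. \<Otimes>y\<in>T. y) \<in> P"
    using fin other by (intro P.finsum_mem) auto
  have own: "(\<Otimes>y\<in>?T. y) \<notin> P"
  proof -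
    have "y \<notin> P" if "y \<in> ?T" for y
      using that P.dvd_power_mem[of y t] t by (auto simp: orbit_class_def)
    then show ?thesis
      using P.finprod_mem_iff[of ?T] finite_orbit_class[OF tR] orbit_class_subset[OF tR] by blast
  qed
  have "orbit_class_sum t = (\<Oplus>T\<in>insert ?T (?C - {?T}). \<Otimes>y\<in>T. y)"
    unfolding orbit_class_sum_def using TC by (simp add: insert_absorb)
  also have "\<dots> = (\<Otimes>y\<in>?T. y) \<oplus> (\<Oplus>T\<in>?C - {?T}. \<Otimes>y\<in>T. y)"
    using fin TC orbit_class_prod_closed[OF tR] by (intro finsum_insert) (auto simp: Pi_def)
  finally have split: "orbit_class_sum t = \<dots>" .
  assume "orbit_class_sum t \<in> P"
  then have "orbit_class_sum t \<oplus> \<ominus> (\<Oplus>T\<in>?C - {?T}. \<Otimes>y\<in>T. y) \<in> P"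
    using rest by (intro P.a_closed P.a_inv_closed)
  moreover have "orbit_class_sum t \<oplus> \<ominus> (\<Oplus>T\<in>?C - {?T}. \<Otimes>y\<in>T. y) = (\<Otimes>y\<in>?T. y)"
    unfolding split using orbit_class_prod_closed[OF tR TC] P.Icarr[OF rest]
    by (simp add: a_assoc r_neg)
  ultimately show False using own by simp
qed

lemma dvd_power_orbit_class_sum:
  assumes a: "a \<in> fixed" and t: "t \<in> carrier R" and le: "dvd_power R a t"
  shows "dvd_power R a (orbit_class_sum t)"
proof (rule dvd_powerI_prime[OF fixed_carrier[OF a] orbit_class_sum_closed[OF t]])
  fix Q assume Q: "primeideal Q R" and aQ: "a \<in> Q"
  interpret Q: primeideal Q R by (rule Q)
  have "y \<in> Q" if y: "y \<in> orbit t" for y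
  proof -
    from y obtain g where s: "g \<in> G" "y = g t" by (auto simp: orbit_def)
    have "dvd_power R (g a) y"
      using le dvd_power_G_iff[OF s(1) fixed_carrier[OF a] t] s(2) by simp
    then show ?thesis
      using Q.dvd_power_mem[of a y] aQ G_closed[OF s(1) t] fixed_by_G[OF a s(1)] s(2) by simp
  qed
  then have "(\<Otimes>y\<in>T. y) \<in> Q" if "T \<in> orbit_class t ` orbit t" for T
    using that Q.finprod_mem_iff[of T] finite_orbit_class[OF t] orbit_class_subset[OF t]
      orbit_class_self[OF t] by blast
  then show "orbit_class_sum t \<in> Q"
    unfolding orbit_class_sum_def using finite_orbit[OF t] by (intro Q.finsum_mem) auto
qed

theorem locally_pqr_fixed:
  assumes "locally_pqr R"
  shows "locally_pqr (R\<lparr>carrier := fixed\<rparr>)"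
proof -
  let ?A = "R\<lparr>carrier := fixed\<rparr>"
  interpret A: domain ?A by (rule domain_fixed)
  show ?thesis
    unfolding A.locally_pqr_iff
  proof (intro allI impI)
    fix p assume p: "primeideal p ?A"
    then obtain P where P: "primeideal P R" "P \<inter> fixed = p" by (rule lying_over_fixed)
    from assms P(1) obtain t where t: "t \<in> carrier R - P"
        and max: "\<And>s. s \<in> carrier R - P \<Longrightarrow> dvd_power R s t"
      unfolding locally_pqr_iff by blast
    let ?f = "orbit_class_sum t"
    have f: "?f \<in> fixed" "?f \<notin> P"
      using orbit_class_sum_fixed orbit_class_sum_notin[OF P(1) t max] t by auto
    have "dvd_power ?A a ?f" if a: "a \<in> fixed - p" for a
    proof (rule dvd_power_fixed)
      have aP: "a \<in> carrier R - P" using a P(2) fixed_carrier by blast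
      show "dvd_power R a ?f" using dvd_power_orbit_class_sum a t max[OF aP] by blast
      show "a \<noteq> \<zero>"
        using aP additive_subgroup.zero_closed[OF ideal.axioms(1)[OF primeideal.axioms(1)[OF P(1)]]]
        by blast
    qed (use a f in auto)
    with f P(2) show "\<exists>f\<in>carrier ?A - p. \<forall>a\<in>carrier ?A - p. dvd_power ?A a f" by auto
  qed
qed

end

theorem theorem2p5:
  fixes R :: "('a, 'm) ring_scheme" and G :: "('a \<Rightarrow> 'a) set"
  assumes "domain R"
    and "subgroup G (RingAutoGroup R)"
    and "locally_finite_action R G"
    and "locally_pqr R"
  shows "locally_pqr (fixed_ring R G)"
proof -
  interpret locally_finite_automorphisms R G
    using assms(1-3)
    by (intro locally_finite_automorphisms.intro locally_finite_automorphisms_axioms.intro)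
  show ?thesis unfolding fixed_ring_eq by (rule locally_pqr_fixed[OF assms(4)])
qed

end
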